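(* Let $\mathcal{H}$ be a complex Hilbert space and let $A,B\in L(\mathcal{H})$. The following conditions are equivalent: (1) $A$ is below $B$ in the minus order, i.e. there exist $P,Q\in L(\mathcal{H})$ with $P^2=P$, $Q^2=Q$, $A=PB$ and $A^*=QB^*$; (2) $R(B)=R(A)\dotplus R(B-A)$ and $\overline{R(B)}=\overline{R(A)}\dotplus\overline{R(B-A)}$.
   Context: $L(\mathcal{H})$ is the algebra of bounded linear operators on $\mathcal{H}$, $R(T)$ is the range of $T$, the bar denotes norm closure, and $\dotplus$ denotes a direct (algebraic) sum of linear subspaces, i.e. a sum of two subspaces with trivial intersection. *)

theory Defs
  imports "HOL-Analysis.Analysis"
begin

text \<open>
  Complex Hilbert spaces. The norm, the topology, completeness and the real vector space structure
  are those of the library class \<open>banach\<close>; the complex scalar multiplication extends \<open>scaleR\<close>, and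
  the inner product (linear in the first argument) induces the norm. Positivity and definiteness of
  the inner product are contained in \<open>cinner_self\<close>.
\<close>

class complex_hilbert_space = banach +
  fixes scaleC :: "complex \<Rightarrow> 'a \<Rightarrow> 'a" (infixr \<open>*\<^sub>C\<close> 75)
    and cinner :: "'a \<Rightarrow> 'a \<Rightarrow> complex"
  assumes scaleC_add_right: "a *\<^sub>C (x + y) = a *\<^sub>C x + a *\<^sub>C y"
    and scaleC_add_left: "(a + b) *\<^sub>C x = a *\<^sub>C x + b *\<^sub>C x"
    and scaleC_scaleC: "a *\<^sub>C b *\<^sub>C x = (a * b) *\<^sub>C x"
    and scaleC_one: "1 *\<^sub>C x = x"
    and scaleC_of_real: "complex_of_real r *\<^sub>C x = r *\<^sub>R x"
    and cinner_commute: "cinner x y = cnj (cinner y x)"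
    and cinner_add_left: "cinner (x + y) z = cinner x z + cinner y z"
    and cinner_scaleC_left: "cinner (a *\<^sub>C x) y = a * cinner x y"
    and cinner_self: "cinner x x = complex_of_real ((norm x)\<^sup>2)"

instantiation complex :: complex_hilbert_space
begin

definition scaleC_complex :: "complex \<Rightarrow> complex \<Rightarrow> complex" where
  "scaleC_complex a x = a * x"

definition cinner_complex :: "complex \<Rightarrow> complex \<Rightarrow> complex" where
  "cinner_complex x y = x * cnj y"

instance
  by standard
    (simp_all add: scaleC_complex_def cinner_complex_def algebra_simps scaleR_conv_of_real
      flip: complex_norm_square)

end

lemma vector_space_scaleC: "vector_space ((*\<^sub>C) :: complex \<Rightarrow> 'a \<Rightarrow> 'a::complex_hilbert_space)"
  by unfold_locales
    (simp_all add: scaleC_add_right scaleC_add_left scaleC_scaleC scaleC_one)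

definition bounded_clinear :: "('a \<Rightarrow> 'a::complex_hilbert_space) \<Rightarrow> bool" where
  "bounded_clinear A \<longleftrightarrow>
     Vector_Spaces.linear (*\<^sub>C) (*\<^sub>C) A \<and> (\<exists>K. \<forall>x. norm (A x) \<le> K * norm x)"

text \<open>
  The adjoint is the unique map satisfying the defining identity; for bounded operators it exists
  by the Riesz representation theorem.
\<close>

definition cadjoint ::
    "('a \<Rightarrow> 'a::complex_hilbert_space) \<Rightarrow> 'a \<Rightarrow> 'a" where
  "cadjoint A = (THE G. \<forall>x y. cinner (A x) y = cinner x (G y))"

definition minus_le ::
    "('a \<Rightarrow> 'a::complex_hilbert_space) \<Rightarrow> ('a \<Rightarrow> 'a) \<Rightarrow> bool" where
  "minus_le A B \<longleftrightarrow>
     (\<exists>P Q. bounded_clinear P \<and> bounded_clinear Q \<and> P \<circ> P = P \<and> Q \<circ> Q = Q \<and>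
        A = P \<circ> B \<and> cadjoint A = Q \<circ> cadjoint B)"

definition is_direct_sum :: "'a::ab_group_add set \<Rightarrow> 'a set \<Rightarrow> 'a set \<Rightarrow> bool" where
  "is_direct_sum M S T \<longleftrightarrow> M = {s + t | s t. s \<in> S \<and> t \<in> T} \<and> S \<inter> T = {0}"

end

(*
  If A = P B and A^* = Q B^*, then E = Q^* satisfies A = P B = B E, hence B - A = (1 - P) B = B (1 - E).
  So both ranges lie in R(B), and the bounded operator P is the identity on the closure of R(A) and
  vanishes on the closure of R(B - A), which gives both direct sums.

  Conversely, the closed graph theorem makes the projection P of the closure of R(B) onto the closure
  of R(A) along the closure of R(B - A) bounded, and P B = A. As R(A) is contained in R(B), Douglas'
  lemma gives a bounded D with A = B D and R(D) orthogonal to ker B. Then B D D = A D = P B D = P A = A = B D,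
  and injectivity of B on the orthogonal complement of its kernel yields D D = D, so Q = D^* works.
*)
theory Submission
  imports Defs
begin

subsection \<open>The closed graph theorem\<close>

text \<open>This is the Baire category half of the closed graph theorem. The sets where
  \<open>norm (f x) \<le> n\<close> cover the space, so one of them is dense in a ball; differences
  of its points are dense near 0, and scaling turns this into a bound proportional to
  \<open>norm z\<close>.\<close>

lemma approximate_by_bounded_image:
  fixes f :: "'a::banach \<Rightarrow> 'b::real_normed_vector"
  assumes f: "linear f"
  obtains K where "K \<ge> 0" and "\<And>z e. e > 0 \<Longrightarrow> \<exists>w. norm (z - w) < e \<and> norm (f w) \<le> K * norm z"
proof -
  define S where "S n = {x. norm (f x) \<le> real n}" for n
  have "\<exists>n. interior (closure (S n)) \<noteq> {}"
  proof (rule ccontr)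
    assume "\<not> ?thesis"
    \<comment> \<open>A countable union of closed sets with empty interior has empty interior in a
      complete metric space, but these closures cover everything.\<close>
    then have "(euclidean :: 'a topology) interior_of \<Union>(range (\<lambda>n. closure (S n))) = {}"
      by (intro Baire_category_alt disjI1 completely_metrizable_space_euclidean) auto
    moreover have "\<Union>(range (\<lambda>n. closure (S n))) = UNIV"
    proof -
      have "x \<in> closure (S (nat \<lceil>norm (f x)\<rceil>))" for x
        by (rule subsetD[OF closure_subset]) (simp add: S_def real_nat_ceiling_ge)
      then show ?thesis
        by auto
    qed
    ultimately show False
      by simp
  qed
  then obtain n x0 r where r: "r > 0" "ball x0 r \<subseteq> closure (S n)"
    by (meson all_not_in_conv mem_interior)
  \<comment> \<open>Take points of \<open>S n\<close> within \<open>e / 2\<close> of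
    \<open>x0\<close> and of \<open>x0 + z\<close>. Their difference is within \<open>e\<close> of
    \<open>z\<close>, and the two bounds \<open>n\<close> add up to \<open>2 * n\<close>.\<close>
  have approx: "\<exists>w. norm (z - w) < e \<and> norm (f w) \<le> 2 * real n" if "norm z < r" "e > 0" for z e
  proof -
    have "x0 \<in> closure (S n)" "x0 + z \<in> closure (S n)"
      using r that by (auto simp: subset_iff dist_norm)
    moreover have "e / 2 > 0"
      using that by simp
    ultimately obtain u v where "u \<in> S n" "dist u x0 < e / 2" "v \<in> S n" "dist v (x0 + z) < e / 2"
      unfolding closure_approachable by blast
    moreover have "norm (z - (v - u)) \<le> norm (x0 + z - v) + norm (u - x0)"
      using norm_triangle_ineq[of "x0 + z - v" "u - x0"] by (simp add: algebra_simps)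
    moreover have "norm (f (v - u)) \<le> norm (f v) + norm (f u)"
      by (simp add: f linear_diff norm_triangle_ineq4)
    ultimately show ?thesis
      by (intro exI[of _ "v - u"]) (auto simp: S_def dist_norm norm_minus_commute)
  qed
  show thesis
  proof (rule that[of "4 * real n / r"])
    show "4 * real n / r \<ge> 0"
      using r by simp
  next
    fix z :: 'a and e :: real
    assume e: "e > 0"
    show "\<exists>w. norm (z - w) < e \<and> norm (f w) \<le> 4 * real n / r * norm z"
    proof (cases "z = 0")
      case True
      then show ?thesis
        using e f by (intro exI[of _ 0]) (simp add: linear_0)
    next
      case False
      \<comment> \<open>The factor \<open>s\<close> brings \<open>z\<close> to norm
        \<open>r / 2\<close>, inside the ball. Undoing it turns the bound \<open>2 * n\<close> into
        \<open>2 * n / s = 4 * n / r * norm z\<close>.\<close>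
      define s where "s = r / (2 * norm z)"
      have s: "s > 0"
        using r False by (simp add: s_def)
      have "norm (s *\<^sub>R z) < r"
        using r False by (simp add: s_def)
      then obtain w where w: "norm (s *\<^sub>R z - w) < s * e" "norm (f w) \<le> 2 * real n"
        using approx s e by (meson mult_pos_pos)
      have "s *\<^sub>R (z - w /\<^sub>R s) = s *\<^sub>R z - w"
        using s by (simp add: scaleR_diff_right)
      then have "s * norm (z - w /\<^sub>R s) < s * e"
        using w(1) s by (metis abs_of_pos norm_scaleR)
      then have "norm (z - w /\<^sub>R s) < e"
        using s by simp
      moreover have "norm (f (w /\<^sub>R s)) \<le> 4 * real n / r * norm z"
        using w(2) s r False by (simp add: linear_scale[OF f] s_def field_simps)
      ultimately show ?thesis
        by blast
    qed
  qed
qed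

text \<open>Each vector is approximated up to half its norm by one whose image is controlled.
  Iterating on the remainder expands \<open>z\<close> into a series whose image series converges
  absolutely; closedness of the graph identifies the sum of the latter as
  \<open>f z\<close>.\<close>

theorem closed_graph_theorem:
  fixes f :: "'a::banach \<Rightarrow> 'b::banach"
  assumes f: "linear f"
    and closed: "\<And>X x y. X \<longlonglongrightarrow> x \<Longrightarrow> (\<lambda>n. f (X n)) \<longlonglongrightarrow> y \<Longrightarrow> f x = y"
  shows "bounded_linear f"
proof -
  obtain K where K: "K \<ge> 0"
    and approx: "\<And>z e. e > 0 \<Longrightarrow> \<exists>w. norm (z - w) < e \<and> norm (f w) \<le> K * norm z"
    using approximate_by_bounded_image[OF f] by blast
  have "\<exists>w. norm (z - w) \<le> norm z / 2 \<and> norm (f w) \<le> K * norm z" for z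
  proof (cases "z = 0")
    case True
    then show ?thesis
      using f by (intro exI[of _ 0]) (simp add: linear_0)
  next
    case False
    then show ?thesis
      using approx[of "norm z / 2" z] by (auto intro: less_imp_le)
  qed
  then obtain h where h: "norm (z - h z) \<le> norm z / 2" "norm (f (h z)) \<le> K * norm z" for z
    by metis
  have "norm (f z) \<le> norm z * (2 * K)" for z
  proof -
    \<comment> \<open>the remainders of expanding \<open>z\<close> greedily as the series \<open>h (R 0) + h (R 1) + \<dots>\<close>\<close>
    define R where "R k = ((\<lambda>x. x - h x) ^^ k) z" for k
    have R_Suc: "R (Suc k) = R k - h (R k)" for k
      by (simp add: R_def)
    have R: "norm (R k) \<le> norm z * (1/2) ^ k" for k
    proof (induction k)
      case 0
      show ?case
        by (simp add: R_def)
    next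
      case (Suc k)
      show ?case
        using h(1)[of "R k"] Suc by (simp add: R_Suc)
    qed
    define c where "c k = K * norm z * (1/2) ^ k" for k :: nat
    have c: "norm (f (h (R k))) \<le> c k" for k
      using order_trans[OF h(2) mult_left_mono[OF R K]] by (simp add: c_def mult_ac)
    have c_sums: "c sums (K * norm z * 2)"
      unfolding c_def using geometric_sums[of "1/2::real"] by (intro sums_mult) simp
    have smb: "summable (\<lambda>k. f (h (R k)))"
      by (rule summable_comparison_test'[OF sums_summable[OF c_sums]]) (rule c)
    \<comment> \<open>The recursion for the remainders telescopes: \<open>z - R k\<close> is the
      \<open>k\<close>-th partial sum of the expansion of \<open>z\<close>.\<close>
    have f_R: "f (z - R k) = (\<Sum>i<k. f (h (R i)))" for k
    proof (induction k)
      case 0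
      show ?case
        by (simp add: R_def linear_0[OF f])
    next
      case (Suc k)
      then show ?case
        by (simp add: R_Suc linear_diff[OF f])
    qed
    have "(\<lambda>k. norm z * (1/2) ^ k) \<longlonglongrightarrow> 0"
      by (intro tendsto_mult_right_zero LIMSEQ_power_zero) simp
    then have "R \<longlonglongrightarrow> 0"
      by (rule Lim_null_comparison[rotated]) (simp add: R)
    then have "(\<lambda>k. z - R k) \<longlonglongrightarrow> z"
      using tendsto_diff[OF tendsto_const, of R 0 _ z] by simp
    moreover have "(\<lambda>k. f (z - R k)) \<longlonglongrightarrow> (\<Sum>i. f (h (R i)))"
      using smb by (simp add: f_R summable_LIMSEQ)
    \<comment> \<open>The partial sums tend to \<open>z\<close> and their images converge, so the
      closed graph applies.\<close>
    ultimately have "f z = (\<Sum>i. f (h (R i)))"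
      by (rule closed)
    also have "norm \<dots> \<le> (\<Sum>i. c i)"
      using norm_suminf_le[OF c sums_summable[OF c_sums]] .
    also have "\<dots> = K * norm z * 2"
      using sums_unique[OF c_sums] by simp
    finally show ?thesis
      by (simp add: mult_ac)
  qed
  then show ?thesis
    using f by (intro bounded_linear_intro[where K = "2 * K"]) (simp_all add: linear_add linear_scale)
qed

subsection \<open>Bounded operators and the inner product\<close>

lemma bounded_clinear_iff:
  "bounded_clinear A \<longleftrightarrow>
     (\<forall>x y. A (x + y) = A x + A y) \<and> (\<forall>c x. A (c *\<^sub>C x) = c *\<^sub>C A x) \<and> (\<exists>K. \<forall>x. norm (A x) \<le> K * norm x)"
  unfolding bounded_clinear_def Vector_Spaces.linear_def module_hom_def module_hom_axioms_def
  using vector_space_scaleC[where 'a='a]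
  by (auto simp: vector_space_def module_def)

lemma bounded_clinear_imp_bounded_linear:
  assumes "bounded_clinear A"
  shows "bounded_linear A"
proof -
  obtain K where "norm (A x) \<le> K * norm x" for x
    using assms bounded_clinear_iff by blast
  moreover have "A (r *\<^sub>R x) = r *\<^sub>R A x" for r x
    using assms by (simp add: bounded_clinear_iff flip: scaleC_of_real)
  ultimately show ?thesis
    using assms by (intro bounded_linear_intro[of A K]) (simp_all add: bounded_clinear_iff mult.commute)
qed

lemma bounded_clinear_scaleC: "bounded_clinear A \<Longrightarrow> A (c *\<^sub>C x) = c *\<^sub>C A x"
  by (simp add: bounded_clinear_iff)

lemma bounded_clinearI:
  "bounded_linear A \<Longrightarrow> (\<And>c x. A (c *\<^sub>C x) = c *\<^sub>C A x) \<Longrightarrow> bounded_clinear A"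
  unfolding bounded_clinear_iff
  by (metis bounded_linear.bounded linear_add bounded_linear.linear mult.commute)

interpretation scaleC: vector_space "scaleC :: complex \<Rightarrow> 'a \<Rightarrow> 'a::complex_hilbert_space"
  by (rule vector_space_scaleC)

text \<open>The closed graph theorem for an operator described by a total, single-valued relation.
  Both kinds of projection and the Douglas factor are obtained from it, so that none of them needs a
  norm estimate of its own.\<close>

lemma bounded_clinear_of_closed_relation:
  fixes R :: "'a::complex_hilbert_space \<Rightarrow> 'a \<Rightarrow> bool"
  assumes ex: "\<And>x. \<exists>y. R x y"
    and unique: "\<And>x y z. R x y \<Longrightarrow> R x z \<Longrightarrow> y = z"
    and add: "\<And>x y u v. R x u \<Longrightarrow> R y v \<Longrightarrow> R (x + y) (u + v)"
    and scale: "\<And>c x u. R x u \<Longrightarrow> R (c *\<^sub>C x) (c *\<^sub>C u)"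
    and closed: "\<And>X Y x y. (\<And>n. R (X n) (Y n)) \<Longrightarrow> X \<longlonglongrightarrow> x \<Longrightarrow> Y \<longlonglongrightarrow> y \<Longrightarrow> R x y"
  obtains f where "bounded_clinear f" and "\<And>x. R x (f x)"
proof -
  obtain f where f: "R x (f x)" for x
    using ex by metis
  have scaleC: "f (c *\<^sub>C x) = c *\<^sub>C f x" for c x
    using unique f scale by blast
  have "f (x + y) = f x + f y" for x y
    using unique f add by blast
  then have "linear f"
    by (auto intro!: linearI simp: scaleC simp flip: scaleC_of_real)
  then have "bounded_linear f"
    by (rule closed_graph_theorem) (rule unique[OF f closed[OF f]])
  then show thesis
    using that f scaleC bounded_clinearI by blast
qed

section \<open>Sesquilinearity, the Cauchy-Schwarz inequality and continuity of the inner
  product\<close>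

lemma cinner_add_right: "cinner x (y + z) = cinner x y + cinner x z"
  by (metis cinner_add_left cinner_commute complex_cnj_add)

lemma cinner_scaleC_right: "cinner x (a *\<^sub>C y) = cnj a * cinner x y"
  by (metis cinner_commute cinner_scaleC_left complex_cnj_mult)

lemma cinner_scaleR_left: "cinner (r *\<^sub>R x) y = r *\<^sub>R cinner x y"
  by (simp add: cinner_scaleC_left scaleR_conv_of_real flip: scaleC_of_real)

lemma cinner_scaleR_right: "cinner x (r *\<^sub>R y) = r *\<^sub>R cinner x y"
  by (simp add: cinner_scaleC_right scaleR_conv_of_real flip: scaleC_of_real)

lemma cinner_diff_left: "cinner (x - y) z = cinner x z - cinner y z"
  by (metis add_diff_cancel cinner_add_left diff_add_cancel)

lemma cinner_diff_right: "cinner x (y - z) = cinner x y - cinner x z"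
  by (metis add_diff_cancel cinner_add_right diff_add_cancel)

text \<open>Pythagoras: removing from \<open>x\<close> its component along \<open>y\<close> leaves a
  vector orthogonal to \<open>y\<close>. Nonnegativity of the left side gives Cauchy-Schwarz;
  applied at a closest point, the formula gives orthogonality.\<close>

lemma norm_minus_cproj:
  fixes x y :: "'a::complex_hilbert_space"
  assumes "y \<noteq> 0"
  shows "(norm (x - (cinner x y / (norm y)\<^sup>2) *\<^sub>C y))\<^sup>2 = (norm x)\<^sup>2 - (norm (cinner x y))\<^sup>2 / (norm y)\<^sup>2"
proof -
  let ?z = "x - (cinner x y / (norm y)\<^sup>2) *\<^sub>C y"
  have orth: "cinner ?z y = 0"
    using assms by (simp add: cinner_diff_left cinner_scaleC_left cinner_self)
  have "complex_of_real ((norm ?z)\<^sup>2) = cinner ?z ?z"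
    by (rule cinner_self[symmetric])
  also have "\<dots> = cinner ?z x"
    using orth by (subst cinner_diff_right) (simp add: cinner_scaleC_right)
  also have "\<dots> = complex_of_real ((norm x)\<^sup>2) - cinner x y * cnj (cinner x y) / (norm y)\<^sup>2"
    by (simp add: cinner_diff_left cinner_scaleC_left cinner_self flip: cinner_commute[of y x])
  also have "\<dots> = complex_of_real ((norm x)\<^sup>2 - (norm (cinner x y))\<^sup>2 / (norm y)\<^sup>2)"
    by (simp flip: complex_norm_square)
  finally show ?thesis
    using of_real_eq_iff by blast
qed

lemma norm_cinner_le: "norm (cinner x y) \<le> norm x * norm y"
proof (cases "y = 0")
  case True
  have "cinner x 0 = 0"
    using cinner_add_right[of x 0 0] by simp
  then show ?thesis
    using True by simp
next
  case False
  have "0 \<le> (norm x)\<^sup>2 - (norm (cinner x y))\<^sup>2 / (norm y)\<^sup>2"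
    by (metis norm_minus_cproj[OF False] zero_le_power2)
  then have "(norm (cinner x y))\<^sup>2 \<le> (norm x * norm y)\<^sup>2"
    using False by (simp add: field_simps power_mult_distrib)
  then show ?thesis
    by (rule power2_le_imp_le) simp
qed

lemma bounded_bilinear_cinner:
  "bounded_bilinear (cinner :: 'a::complex_hilbert_space \<Rightarrow> 'a \<Rightarrow> complex)"
proof
  show "\<exists>K. \<forall>x y :: 'a. norm (cinner x y) \<le> norm x * norm y * K"
    by (intro exI[of _ 1]) (simp add: norm_cinner_le)
qed (fact cinner_add_left cinner_add_right cinner_scaleR_left cinner_scaleR_right)+

interpretation cinner: bounded_bilinear "cinner :: 'a::complex_hilbert_space \<Rightarrow> 'a \<Rightarrow> complex"
  by (rule bounded_bilinear_cinner)

lemma norm_diff_power2: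
  "(norm (x - y))\<^sup>2 = (norm x)\<^sup>2 + (norm y)\<^sup>2 - 2 * Re (cinner x y)"
proof -
  have sq: "(norm u)\<^sup>2 = Re (cinner u u)" for u :: 'a
    by (simp add: cinner_self)
  have "Re (cinner y x) = Re (cinner x y)"
    by (subst cinner_commute) simp
  then show ?thesis
    by (simp add: sq cinner_diff_left cinner_diff_right)
qed

subsection \<open>Orthogonal decomposition and adjoints\<close>

lemma parallelogram_law:
  fixes x y :: "'a::complex_hilbert_space"
  shows "(norm (x + y))\<^sup>2 + (norm (x - y))\<^sup>2 = 2 * (norm x)\<^sup>2 + 2 * (norm y)\<^sup>2"
  using norm_diff_power2[of x y] norm_diff_power2[of x "- y"] by (simp add: cinner.minus_right)

lemma subspace_scaleR:
  "scaleC.subspace M \<Longrightarrow> x \<in> M \<Longrightarrow> r *\<^sub>R x \<in> M"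
  by (metis scaleC.subspace_scale scaleC_of_real)

text \<open>A minimizing sequence for the distance to \<open>M\<close> is Cauchy by the
  parallelogram law, because midpoints of its members stay in \<open>M\<close>. Its limit lies in
  \<open>M\<close> by closedness.\<close>

lemma closest_point_exists:
  fixes M :: "'a::complex_hilbert_space set"
  assumes M: "scaleC.subspace M" "closed M"
  obtains p where "p \<in> M" and "\<And>m. m \<in> M \<Longrightarrow> norm (x - p) \<le> norm (x - m)"
proof -
  define d where "d = infdist x M"
  have M0: "M \<noteq> {}"
    using scaleC.subspace_0[OF M(1)] by blast
  have d_le: "d \<le> norm (x - m)" if "m \<in> M" for m
    using infdist_le[OF that] by (simp add: d_def dist_norm)
  have d0: "d \<ge> 0"
    by (simp add: d_def infdist_nonneg)
  have "\<exists>m\<in>M. norm (x - m) < d + inverse (real (Suc n))" for n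
  proof (rule ccontr)
    assume "\<not> ?thesis"
    then have "d + inverse (real (Suc n)) \<le> infdist x M"
      using M0 by (auto simp: infdist_notempty dist_norm not_less intro!: cINF_greatest)
    then show False
      by (simp add: d_def)
  qed
  then obtain X where X: "X n \<in> M" "norm (x - X n) < d + inverse (real (Suc n))" for n
    by metis
  have d_lim: "(\<lambda>n. norm (x - X n)) \<longlonglongrightarrow> d"
  proof (rule tendsto_sandwich[where f = "\<lambda>_. d" and h = "\<lambda>n. d + inverse (real (Suc n))"])
    show "(\<lambda>n. d + inverse (real (Suc n))) \<longlonglongrightarrow> d"
      using tendsto_add[OF tendsto_const LIMSEQ_inverse_real_of_nat, of d] by simp
    show "\<forall>\<^sub>F n in sequentially. d \<le> norm (x - X n)"
      by (simp add: X(1) d_le)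
    show "\<forall>\<^sub>F n in sequentially. norm (x - X n) \<le> d + inverse (real (Suc n))"
      using X(2) by (intro always_eventually allI less_imp_le)
  qed simp
  \<comment> \<open>The sum of \<open>x - X m\<close> and \<open>x - X n\<close> is twice the
    difference of \<open>x\<close> and the midpoint, so its norm is at least \<open>2 * d\<close>.
    The parallelogram law then bounds their difference.\<close>
  have X_diff: "(norm (X m - X n))\<^sup>2 \<le> 2 * (norm (x - X m))\<^sup>2 + 2 * (norm (x - X n))\<^sup>2 - 4 * d\<^sup>2" for m n
  proof -
    have "(1/2) *\<^sub>R (X m + X n) \<in> M"
      using X M(1) by (intro subspace_scaleR scaleC.subspace_add)
    then have "d \<le> norm (x - (1/2) *\<^sub>R (X m + X n))"
      by (rule d_le)
    then have "(2 * d)\<^sup>2 \<le> (2 * norm (x - (1/2) *\<^sub>R (X m + X n)))\<^sup>2"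
      using d0 by (intro power_mono) auto
    also have "2 * norm (x - (1/2) *\<^sub>R (X m + X n)) = norm (2 *\<^sub>R (x - (1/2) *\<^sub>R (X m + X n)))"
      by simp
    also have "2 *\<^sub>R (x - (1/2) *\<^sub>R (X m + X n)) = (x - X m) + (x - X n)"
      by (simp add: scaleR_diff_right scaleR_2)
    finally have "(2 * d)\<^sup>2 \<le> (norm ((x - X m) + (x - X n)))\<^sup>2" .
    moreover have "norm (X m - X n) = norm ((x - X m) - (x - X n))"
      by (simp add: norm_minus_commute)
    ultimately show ?thesis
      using parallelogram_law[of "x - X m" "x - X n"] by (simp add: power_mult_distrib)
  qed
  have "Cauchy X"
  proof (rule metric_CauchyI)
    fix e :: real
    assume e: "e > 0"
    have "(\<lambda>n. (norm (x - X n))\<^sup>2) \<longlonglongrightarrow> d\<^sup>2"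
      by (intro tendsto_power d_lim)
    \<comment> \<open>The margin is chosen so that \<open>X_diff\<close> gives
      \<open>4 * (d^2 + e^2 / 4) - 4 * d^2 = e^2\<close>.\<close>
    moreover have "d\<^sup>2 < d\<^sup>2 + e\<^sup>2 / 4"
      using e by simp
    ultimately have "\<forall>\<^sub>F n in sequentially. (norm (x - X n))\<^sup>2 < d\<^sup>2 + e\<^sup>2 / 4"
      by (rule order_tendstoD(2))
    then obtain N where N: "(norm (x - X n))\<^sup>2 < d\<^sup>2 + e\<^sup>2 / 4" if "n \<ge> N" for n
      unfolding eventually_sequentially by blast
    have "dist (X m) (X n) < e" if "m \<ge> N" "n \<ge> N" for m n
    proof -
      have "(norm (X m - X n))\<^sup>2 < e\<^sup>2"
        using X_diff[of m n] N[OF that(1)] N[OF that(2)] by linarith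
      then show ?thesis
        using e by (simp add: dist_norm power_less_imp_less_base)
    qed
    then show "\<exists>N. \<forall>m\<ge>N. \<forall>n\<ge>N. dist (X m) (X n) < e"
      by blast
  qed
  then obtain p where p: "X \<longlonglongrightarrow> p"
    unfolding Cauchy_convergent_iff convergent_def ..
  have "p \<in> M"
    using M(2) X(1) p by (rule closed_sequentially)
  moreover have "norm (x - p) = d"
    using LIMSEQ_unique[OF tendsto_norm[OF tendsto_diff[OF tendsto_const p]] d_lim] .
  ultimately show thesis
    using that[of p] d_le by simp
qed

text \<open>The closest point \<open>p\<close> works: if \<open>x - p\<close> had a nonzero
  component along some \<open>m\<close> in \<open>M\<close>, adding that component to
  \<open>p\<close> would bring it closer to \<open>x\<close>.\<close>

lemma orthogonal_decomposition_exists: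
  fixes M :: "'a::complex_hilbert_space set"
  assumes M: "scaleC.subspace M" "closed M"
  obtains p where "p \<in> M" and "\<And>m. m \<in> M \<Longrightarrow> cinner (x - p) m = 0"
proof -
  obtain p where pM: "p \<in> M" and p: "\<And>m. m \<in> M \<Longrightarrow> norm (x - p) \<le> norm (x - m)"
    using closest_point_exists[OF M, of x] by blast
  have "cinner (x - p) m = 0" if m: "m \<in> M" for m
  proof (cases "m = 0")
    case True
    then show ?thesis
      by (simp add: cinner.zero_right)
  next
    case False
    let ?c = "cinner (x - p) m / (norm m)\<^sup>2"
    have "p + ?c *\<^sub>C m \<in> M"
      using M(1) pM m by (simp add: scaleC.subspace_add scaleC.subspace_scale)
    then have "(norm (x - p))\<^sup>2 \<le> (norm (x - p - ?c *\<^sub>C m))\<^sup>2"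
      using p by (intro power_mono) (auto simp: diff_diff_eq)
    also have "\<dots> = (norm (x - p))\<^sup>2 - (norm (cinner (x - p) m))\<^sup>2 / (norm m)\<^sup>2"
      by (rule norm_minus_cproj[OF False])
    finally show ?thesis
      using False by (simp add: divide_le_0_iff)
  qed
  then show thesis
    using that pM by blast
qed

text \<open>For nonzero \<open>\<phi>\<close>, pick \<open>z\<close> orthogonal to its closed kernel
  with \<open>\<phi> z \<noteq> 0\<close>. Then \<open>x - (\<phi> x / \<phi> z) *\<^sub>C z\<close>
  lies in the kernel, so \<open>\<phi>\<close> is the inner product with a multiple of
  \<open>z\<close>. The scalar is conjugated because \<open>cinner\<close> is conjugate linear in
  its second argument.\<close>

lemma riesz_representation:
  fixes \<phi> :: "'a::complex_hilbert_space \<Rightarrow> complex"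
  assumes \<phi>: "bounded_linear \<phi>" and scale: "\<And>c x. \<phi> (c *\<^sub>C x) = c * \<phi> x"
  obtains g where "\<And>x. \<phi> x = cinner x g"
proof (cases "\<forall>x. \<phi> x = 0")
  case True
  then show thesis
    using that[of 0] by (simp add: cinner.zero_right)
next
  case False
  then obtain x0 where x0: "\<phi> x0 \<noteq> 0"
    by blast
  interpret \<phi>: bounded_linear \<phi>
    by (rule \<phi>)
  have "scaleC.subspace {x. \<phi> x = 0}"
    by (auto simp: scaleC.subspace_def \<phi>.zero \<phi>.add scale)
  moreover have "closed {x. \<phi> x = 0}"
    by (intro closed_Collect_eq \<phi>.continuous_on continuous_on_id continuous_on_const)
  ultimately obtain p where "p \<in> {x. \<phi> x = 0}"
    and p: "\<And>m. m \<in> {x. \<phi> x = 0} \<Longrightarrow> cinner (x0 - p) m = 0"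
    using orthogonal_decomposition_exists[of "{x. \<phi> x = 0}" x0] by blast
  define z where "z = x0 - p"
  have \<phi>z: "\<phi> z \<noteq> 0"
    using x0 \<open>p \<in> _\<close> by (simp add: z_def \<phi>.diff)
  then have z: "cinner z z \<noteq> 0"
    by (auto simp: cinner_self \<phi>.zero)
  have "\<phi> x = cinner x (cnj (\<phi> z / cinner z z) *\<^sub>C z)" for x
  proof -
    have "\<phi> (x - (\<phi> x / \<phi> z) *\<^sub>C z) = 0"
      using \<phi>z by (simp add: \<phi>.diff scale)
    then have "cinner z (x - (\<phi> x / \<phi> z) *\<^sub>C z) = 0"
      unfolding z_def by (intro p) simp
    then have "cinner (x - (\<phi> x / \<phi> z) *\<^sub>C z) z = 0"
      by (metis cinner_commute complex_cnj_zero)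
    then show ?thesis
      using z \<phi>z by (simp add: cinner_diff_left cinner_scaleC_left cinner_scaleC_right field_simps)
  qed
  then show thesis
    by (rule that)
qed

section \<open>Existence and uniqueness of adjoints\<close>

lemma cinner_ext:
  assumes "\<And>x. cinner x y = cinner x z"
  shows "y = z"
proof -
  have "cinner (y - z) (y - z) = 0"
    by (simp add: cinner_diff_right assms)
  then show ?thesis
    by (simp add: cinner_self)
qed

lemma cadjoint_eqI:
  assumes "\<And>x y. cinner (A x) y = cinner x (G y)"
  shows "cadjoint A = G"
  unfolding cadjoint_def
proof (rule the_equality)
  fix H
  assume H: "\<forall>x y. cinner (A x) y = cinner x (H y)"
  show "H = G"
  proof (rule ext, rule cinner_ext)
    fix x y
    show "cinner x (H y) = cinner x (G y)"
      using H assms[of x y] by simp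
  qed
qed (simp add: assms)

text \<open>Riesz representation of \<open>x \<mapsto> cinner (A x) y\<close> yields
  \<open>G y\<close> for each \<open>y\<close>. Linearity follows by testing against all vectors,
  and any bound \<open>K\<close> for \<open>A\<close> also bounds \<open>G\<close>.\<close>

lemma adjoint_exists:
  assumes A: "bounded_clinear A"
  obtains G where "bounded_clinear G" and "\<And>x y. cinner (A x) y = cinner x (G y)"
proof -
  have A': "bounded_linear A"
    using A by (rule bounded_clinear_imp_bounded_linear)
  have "\<exists>g. \<forall>x. cinner (A x) y = cinner x g" for y
  proof -
    have "bounded_linear (\<lambda>x. cinner (A x) y)"
      by (rule bounded_linear_compose[OF cinner.bounded_linear_left A'])
    moreover have "cinner (A (c *\<^sub>C x)) y = c * cinner (A x) y" for c x
      by (simp add: bounded_clinear_scaleC[OF A] cinner_scaleC_left)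
    ultimately obtain g where "\<And>x. cinner (A x) y = cinner x g"
      by (rule riesz_representation) blast
    then show ?thesis
      by blast
  qed
  then have "\<exists>G. \<forall>y x. cinner (A x) y = cinner x (G y)"
    by (intro choice allI)
  then obtain G where G: "\<And>x y. cinner (A x) y = cinner x (G y)"
    by blast
  obtain K where K: "\<And>x. norm (A x) \<le> K * norm x"
    using A unfolding bounded_clinear_iff by blast
  have "norm (G y) \<le> K * norm y" for y
  proof (cases "G y = 0")
    \<comment> \<open>The sign of \<open>K\<close> is unknown, but
      \<open>0 \<le> norm (A y) \<le> K * norm y\<close>.\<close>
    case True
    then show ?thesis
      using order_trans[OF norm_ge_zero K] by simp
  next
    case False
    \<comment> \<open>Testing the adjoint identity at \<open>x = G y\<close> gives
      \<open>cinner (A (G y)) y = cinner (G y) (G y)\<close>; one factor \<open>norm (G y)\<close>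
      cancels at the end.\<close>
    have "(norm (G y))\<^sup>2 = norm (cinner (A (G y)) y)"
      by (simp add: G cinner_self norm_power)
    also have "\<dots> \<le> norm (A (G y)) * norm y"
      by (rule norm_cinner_le)
    also have "\<dots> \<le> K * norm (G y) * norm y"
      by (intro mult_right_mono K) simp
    finally have "norm (G y) * norm (G y) \<le> norm (G y) * (K * norm y)"
      by (simp add: power2_eq_square mult_ac)
    then show ?thesis
      using False by simp
  qed
  moreover have "G (x + y) = G x + G y" for x y
    by (rule cinner_ext) (simp add: cinner_add_right flip: G)
  moreover have "G (c *\<^sub>C x) = c *\<^sub>C G x" for c x
    by (rule cinner_ext) (simp add: cinner_scaleC_right flip: G)
  ultimately have "bounded_clinear G"
    unfolding bounded_clinear_iff by blast
  then show thesis
    using G by (rule that)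
qed

lemma
  assumes "bounded_clinear A"
  shows bounded_clinear_cadjoint: "bounded_clinear (cadjoint A)"
    and cinner_cadjoint: "cinner (A x) y = cinner x (cadjoint A y)"
proof -
  obtain G where G: "bounded_clinear G" "\<And>x y. cinner (A x) y = cinner x (G y)"
    using adjoint_exists[OF assms] by blast
  then have "cadjoint A = G"
    by (intro cadjoint_eqI)
  then show "bounded_clinear (cadjoint A)" "cinner (A x) y = cinner x (cadjoint A y)"
    using G by simp_all
qed

lemma cinner_cadjoint':
  assumes "bounded_clinear A"
  shows "cinner (cadjoint A x) y = cinner x (A y)"
  by (subst (1 2) cinner_commute) (simp add: cinner_cadjoint[OF assms])

subsection \<open>Projections and Douglas factorization\<close>

text \<open>The class postulates compatibility of the norm with real scalars only;
  \<open>norm (c *\<^sub>C y) = norm c * norm y\<close> is recovered from the inner product.\<close>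

lemma scaleC_tendsto:
  assumes "X \<longlonglongrightarrow> x"
  shows "(\<lambda>n. c *\<^sub>C X n) \<longlonglongrightarrow> c *\<^sub>C (x :: 'a::complex_hilbert_space)"
proof (rule bounded_linear.tendsto[OF _ assms])
  have "norm (c *\<^sub>C y) = norm y * norm c" for y :: 'a
  proof -
    have "complex_of_real ((norm (c *\<^sub>C y))\<^sup>2) = c * cnj c * cinner y y"
      unfolding cinner_self[symmetric] by (simp add: cinner_scaleC_left cinner_scaleC_right)
    also have "\<dots> = complex_of_real ((norm y * norm c)\<^sup>2)"
      by (simp add: cinner_self power_mult_distrib flip: complex_norm_square)
    finally have "(norm (c *\<^sub>C y))\<^sup>2 = (norm y * norm c)\<^sup>2"
      using of_real_eq_iff by blast
    then show ?thesis
      by (rule power2_eq_imp_eq) simp_all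
  qed
  moreover have "c *\<^sub>C r *\<^sub>R y = r *\<^sub>R c *\<^sub>C y" for r and y :: 'a
    by (metis scaleC_of_real scaleC_scaleC mult.commute)
  ultimately show "bounded_linear (\<lambda>y :: 'a. c *\<^sub>C y)"
    by (intro bounded_linear_intro[where K = "norm c"]) (simp_all add: scaleC_add_right)
qed

lemma subspace_closure:
  fixes M :: "'a::complex_hilbert_space set"
  assumes M: "scaleC.subspace M"
  shows "scaleC.subspace (closure M)"
proof (rule scaleC.subspaceI)
  show "0 \<in> closure M"
    using scaleC.subspace_0[OF M] closure_subset by blast
next
  fix x y
  assume "x \<in> closure M" "y \<in> closure M"
  then obtain X Y where "\<forall>n. X n \<in> M" "X \<longlonglongrightarrow> x" "\<forall>n. Y n \<in> M" "Y \<longlonglongrightarrow> y"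
    unfolding closure_sequential by blast
  then have "\<forall>n. X n + Y n \<in> M" "(\<lambda>n. X n + Y n) \<longlonglongrightarrow> x + y"
    by (simp_all add: scaleC.subspace_add[OF M] tendsto_add)
  then show "x + y \<in> closure M"
    by (intro closure_sequential[THEN iffD2] exI conjI)
next
  fix c x
  assume "x \<in> closure M"
  then obtain X where "\<forall>n. X n \<in> M" "X \<longlonglongrightarrow> x"
    unfolding closure_sequential by blast
  then have "\<forall>n. c *\<^sub>C X n \<in> M" "(\<lambda>n. c *\<^sub>C X n) \<longlonglongrightarrow> c *\<^sub>C x"
    by (simp_all add: scaleC.subspace_scale[OF M] scaleC_tendsto)
  then show "c *\<^sub>C x \<in> closure M"
    by (intro closure_sequential[THEN iffD2] exI conjI)
qed

lemma subspace_range: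
  assumes A: "bounded_clinear A"
  shows "scaleC.subspace (range A)"
proof -
  interpret A: bounded_linear A
    using A by (rule bounded_clinear_imp_bounded_linear)
  show ?thesis
  proof (rule scaleC.subspaceI)
    show "0 \<in> range A"
      using A.zero by (metis rangeI)
    show "x + y \<in> range A" if "x \<in> range A" "y \<in> range A" for x y
      using that by (auto simp flip: A.add)
    show "c *\<^sub>C x \<in> range A" if "x \<in> range A" for c x
      using that by (auto simp flip: bounded_clinear_scaleC[OF A])
  qed
qed

lemma bounded_clinear_diff:
  assumes "bounded_clinear A" "bounded_clinear B"
  shows "bounded_clinear (\<lambda>x. A x - B x)"
proof (rule bounded_clinearI)
  show "bounded_linear (\<lambda>x. A x - B x)"
    using assms by (intro bounded_linear_sub bounded_clinear_imp_bounded_linear)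
qed (simp add: bounded_clinear_scaleC assms scaleC.scale_right_diff_distrib)

text \<open>Operators here are defined on the whole space; this projection serves to extend an
  operator from a closed subspace to all of it. The relation \<open>R x p\<close> says that
  \<open>p\<close> is the orthogonal projection of \<open>x\<close>, and it is closed by continuity
  of \<open>cinner\<close>.\<close>

lemma orthogonal_projection_exists:
  fixes S :: "'a::complex_hilbert_space set"
  assumes S: "scaleC.subspace S" "closed S"
  obtains P where "bounded_clinear P" and "\<And>x. P x \<in> S" and "\<And>x. x \<in> S \<Longrightarrow> P x = x"
proof -
  define R where "R x p \<longleftrightarrow> p \<in> S \<and> (\<forall>s\<in>S. cinner (x - p) s = 0)" for x p
  have unique: "p = q" if "R x p" "R x q" for x p q
  proof -
    have "q - p \<in> S"
      using that S(1) by (simp add: R_def scaleC.subspace_diff)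
    then have "cinner ((x - p) - (x - q)) (q - p) = 0"
      using that by (subst cinner_diff_left) (simp add: R_def)
    then show ?thesis
      by (simp add: cinner_self)
  qed
  obtain P where P: "bounded_clinear P" "\<And>x. R x (P x)"
  proof (rule bounded_clinear_of_closed_relation[of R])
    show "\<exists>p. R x p" for x
    proof -
      obtain p where "p \<in> S" "\<And>s. s \<in> S \<Longrightarrow> cinner (x - p) s = 0"
        using orthogonal_decomposition_exists[OF S, of x] by blast
      then have "R x p"
        by (simp add: R_def)
      then show ?thesis ..
    qed
    show "p = q" if "R x p" "R x q" for x p q
      using that by (rule unique)
    show "R (x + y) (u + v)" if "R x u" "R y v" for x y u v
    proof -
      have "cinner (x + y - (u + v)) s = cinner (x - u) s + cinner (y - v) s" for s
        by (simp add: cinner_add_left cinner_diff_left)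
      moreover have "u + v \<in> S"
        using that unfolding R_def by (intro scaleC.subspace_add S(1); blast)
      ultimately show ?thesis
        using that unfolding R_def by simp
    qed
    show "R (c *\<^sub>C x) (c *\<^sub>C u)" if "R x u" for c x u
    proof -
      have "cinner (c *\<^sub>C x - c *\<^sub>C u) s = c * cinner (x - u) s" for s
        by (simp add: cinner_diff_left cinner_scaleC_left right_diff_distrib)
      moreover have "c *\<^sub>C u \<in> S"
        using that unfolding R_def by (intro scaleC.subspace_scale S(1)) blast
      ultimately show ?thesis
        using that unfolding R_def by simp
    qed
    show "R x y" if R: "\<And>n. R (X n) (Y n)" and lim: "X \<longlonglongrightarrow> x" "Y \<longlonglongrightarrow> y" for X Y x y
    proof -
      have "y \<in> S"
        using R by (intro closed_sequentially[OF S(2) _ lim(2)]) (simp add: R_def)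
      moreover have "cinner (x - y) s = 0" if "s \<in> S" for s
      proof -
        have "(\<lambda>n. cinner (X n - Y n) s) \<longlonglongrightarrow> cinner (x - y) s"
          by (intro cinner.tendsto tendsto_diff lim tendsto_const)
        then show ?thesis
          using R that by (simp add: R_def LIMSEQ_const_iff)
      qed
      ultimately show ?thesis
        by (simp add: R_def)
    qed
  qed (rule that)
  show thesis
  proof (rule that[OF P(1)])
    show "P x \<in> S" for x
      using P(2) by (simp add: R_def)
    show "P x = x" if "x \<in> S" for x
      using P(2) by (rule unique) (simp add: R_def that cinner.zero_left)
  qed
qed

text \<open>First project orthogonally onto the closed sum \<open>S\<close> by \<open>T\<close>,
  then take the \<open>M\<close>-component along \<open>N\<close>. Trivial intersection makes this
  component unique, and closedness of \<open>M\<close> and \<open>N\<close> makes its graph closed,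
  hence the map bounded.\<close>

lemma oblique_projection_exists:
  fixes M N :: "'a::complex_hilbert_space set"
  assumes M: "scaleC.subspace M" "closed M"
    and N: "scaleC.subspace N" "closed N"
    and S: "is_direct_sum S M N" "closed S"
  obtains P where "bounded_clinear P" and "\<And>x. P x \<in> M"
    and "\<And>x. x \<in> M \<Longrightarrow> P x = x" and "\<And>x. x \<in> N \<Longrightarrow> P x = 0"
proof -
  have S_eq: "S = {m + n | m n. m \<in> M \<and> n \<in> N}" and MN: "M \<inter> N = {0}"
    using S(1) by (simp_all add: is_direct_sum_def)
  have "scaleC.subspace S"
    unfolding S_eq using scaleC.subspace_sums[OF M(1) N(1)] .
  then obtain T where T: "bounded_clinear T" "\<And>x. T x \<in> S" "\<And>x. x \<in> S \<Longrightarrow> T x = x"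
    using orthogonal_projection_exists S(2) by blast
  interpret T: bounded_linear T
    using T(1) by (rule bounded_clinear_imp_bounded_linear)
  define R where "R x p \<longleftrightarrow> p \<in> M \<and> T x - p \<in> N" for x p
  have unique: "p = q" if "R x p" "R x q" for x p q
  proof -
    have "(T x - q) - (T x - p) \<in> N" "p - q \<in> M"
      using that M(1) N(1) unfolding R_def by (blast intro: scaleC.subspace_diff)+
    then have "p - q \<in> M \<inter> N"
      by simp
    then show ?thesis
      by (simp add: MN)
  qed
  obtain P where P: "bounded_clinear P" "\<And>x. R x (P x)"
  proof (rule bounded_clinear_of_closed_relation[of R])
    show "\<exists>p. R x p" for x
    proof -
      obtain m n where "T x = m + n" "m \<in> M" "n \<in> N"
        using T(2)[of x] unfolding S_eq by blast
      then have "R x m"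
        by (simp add: R_def)
      then show ?thesis ..
    qed
    show "p = q" if "R x p" "R x q" for x p q
      using that by (rule unique)
    show "R (x + y) (u + v)" if "R x u" "R y v" for x y u v
    proof -
      have "(T x - u) + (T y - v) \<in> N" "u + v \<in> M"
        using that unfolding R_def by (intro scaleC.subspace_add M(1) N(1); blast)+
      moreover have "(T x - u) + (T y - v) = T (x + y) - (u + v)"
        by (simp add: T.add)
      ultimately show ?thesis
        unfolding R_def by metis
    qed
    show "R (c *\<^sub>C x) (c *\<^sub>C u)" if "R x u" for c x u
    proof -
      have "c *\<^sub>C (T x - u) \<in> N" "c *\<^sub>C u \<in> M"
        using that unfolding R_def by (intro scaleC.subspace_scale M(1) N(1); blast)+
      then show ?thesis
        by (simp add: R_def bounded_clinear_scaleC[OF T(1)] scaleC.scale_right_diff_distrib)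
    qed
    show "R x y" if R: "\<And>n. R (X n) (Y n)" and lim: "X \<longlonglongrightarrow> x" "Y \<longlonglongrightarrow> y" for X Y x y
      unfolding R_def
    proof
      show "y \<in> M"
        using R by (intro closed_sequentially[OF M(2) _ lim(2)]) (simp add: R_def)
      have "(\<lambda>n. T (X n) - Y n) \<longlonglongrightarrow> T x - y"
        by (intro tendsto_diff T.tendsto lim)
      then show "T x - y \<in> N"
        using R by (elim closed_sequentially[OF N(2), rotated]) (simp add: R_def)
    qed
  qed (rule that)
  show thesis
  proof (rule that[OF P(1)])
    show "P x \<in> M" for x
      using P(2) by (simp add: R_def)
    show "P x = x" if "x \<in> M" for x
    proof (rule unique[OF P(2)])
      have "x + 0 \<in> S"
        unfolding S_eq using that scaleC.subspace_0[OF N(1)] by blast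
      then show "R x x"
        using that scaleC.subspace_0[OF N(1)] by (simp add: R_def T(3))
    qed
    show "P x = 0" if "x \<in> N" for x
    proof (rule unique[OF P(2)])
      have "0 + x \<in> S"
        unfolding S_eq using that scaleC.subspace_0[OF M(1)] by blast
      then show "R x 0"
        using that scaleC.subspace_0[OF M(1)] by (simp add: R_def T(3))
    qed
  qed
qed

text \<open>Among the solutions \<open>y\<close> of \<open>B y = A x\<close> take the one orthogonal
  to the kernel of \<open>B\<close>. Two such solutions differ by a kernel vector orthogonal to
  itself, so the choice is unique; it is linear in \<open>x\<close> with closed graph.\<close>

lemma douglas_factorization:
  fixes A B :: "'a::complex_hilbert_space \<Rightarrow> 'a"
  assumes A: "bounded_clinear A" and B: "bounded_clinear B" and AB: "range A \<subseteq> range B"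
  obtains D where "bounded_clinear D" and "\<And>x. B (D x) = A x"
    and "\<And>x k. B k = 0 \<Longrightarrow> cinner (D x) k = 0"
proof -
  interpret A: bounded_linear A
    using A by (rule bounded_clinear_imp_bounded_linear)
  interpret B: bounded_linear B
    using B by (rule bounded_clinear_imp_bounded_linear)
  define R where "R x y \<longleftrightarrow> B y = A x \<and> (\<forall>k. B k = 0 \<longrightarrow> cinner y k = 0)" for x y
  have ker: "scaleC.subspace {k. B k = 0}" "closed {k. B k = 0}"
    by (auto simp: scaleC.subspace_def B.zero B.add bounded_clinear_scaleC[OF B]
        intro!: closed_Collect_eq B.continuous_on continuous_on_id continuous_on_const)
  obtain D where D: "bounded_clinear D" "\<And>x. R x (D x)"
  proof (rule bounded_clinear_of_closed_relation[of R])
    show "\<exists>y. R x y" for x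
    proof -
      obtain y where y: "A x = B y"
        using AB by blast
      \<comment> \<open>Subtracting from a preimage \<open>y\<close> its kernel component
        \<open>p\<close> leaves \<open>B y\<close> unchanged.\<close>
      obtain p where "p \<in> {k. B k = 0}" "\<And>k. k \<in> {k. B k = 0} \<Longrightarrow> cinner (y - p) k = 0"
        using orthogonal_decomposition_exists[OF ker, of y] by blast
      then have "R x (y - p)"
        by (simp add: R_def y B.diff)
      then show ?thesis ..
    qed
    show "y = z" if "R x y" "R x z" for x y z
    proof -
      have "B (y - z) = 0"
        using that by (simp add: R_def B.diff)
      then have "cinner (y - z) (y - z) = 0"
        using that unfolding R_def cinner_diff_left by simp
      then show ?thesis
        by (simp add: cinner_self)
    qed
    show "R (x + y) (u + v)" if "R x u" "R y v" for x y u v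
      using that by (simp add: R_def A.add B.add cinner_add_left)
    show "R (c *\<^sub>C x) (c *\<^sub>C u)" if "R x u" for c x u
      using that by (simp add: R_def bounded_clinear_scaleC[OF A] bounded_clinear_scaleC[OF B] cinner_scaleC_left)
    show "R x y" if R: "\<And>n. R (X n) (Y n)" and lim: "X \<longlonglongrightarrow> x" "Y \<longlonglongrightarrow> y" for X Y x y
      unfolding R_def
    proof (intro conjI allI impI)
      have "(\<lambda>n. B (Y n)) \<longlonglongrightarrow> A x"
        using A.tendsto[OF lim(1)] R by (simp add: R_def)
      then show "B y = A x"
        using B.tendsto[OF lim(2)] LIMSEQ_unique by blast
    next
      fix k
      assume k: "B k = 0"
      have "(\<lambda>n. cinner (Y n) k) \<longlonglongrightarrow> cinner y k"
        by (intro cinner.tendsto lim tendsto_const)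
      then show "cinner y k = 0"
        using R k by (simp add: R_def LIMSEQ_const_iff)
    qed
  qed (rule that)
  then show thesis
    using that unfolding R_def by blast
qed

subsection \<open>The minus order\<close>

text \<open>Taking adjoints in \<open>cadjoint A = Q \<circ> cadjoint B\<close> turns the left
  factor \<open>Q\<close> into the right factor \<open>E = cadjoint Q\<close>.\<close>

lemma minus_le_imp_factor:
  assumes "bounded_clinear A" "bounded_clinear B"
    and "minus_le A B"
  obtains P E where "bounded_clinear P" and "P \<circ> P = P"
    and "A = P \<circ> B" and "A = B \<circ> E"
proof -
  obtain P Q where P: "bounded_clinear P" "P \<circ> P = P" "A = P \<circ> B"
    and Q: "bounded_clinear Q" "cadjoint A = Q \<circ> cadjoint B"
    using assms(3) unfolding minus_le_def by blast
  have "A x = B (cadjoint Q x)" for x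
  proof -
    have "cinner y (A x) = cinner y (B (cadjoint Q x))" for y
      by (simp add: Q(2) cinner_cadjoint[OF Q(1), symmetric] assms
          cinner_cadjoint'[OF assms(1), symmetric] cinner_cadjoint'[OF assms(2), symmetric])
    then show ?thesis
      by (rule cinner_ext)
  qed
  then have "A = B \<circ> cadjoint Q"
    by auto
  then show thesis
    using that P by blast
qed

text \<open>The map \<open>P\<close> supplies the decomposition \<open>x = P x + (x - P x)\<close>,
  and a vector in both summands satisfies \<open>x = P x = 0\<close>. The same criterion serves for
  the ranges and for their closures.\<close>

lemma is_direct_sumI:
  assumes S: "scaleC.subspace S" and M: "scaleC.subspace M" and N: "scaleC.subspace N"
    and "M \<subseteq> S" "N \<subseteq> S"
    and decomp: "\<And>x. x \<in> S \<Longrightarrow> P x \<in> M \<and> x - P x \<in> N"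
    and PM: "\<And>x. x \<in> M \<Longrightarrow> P x = x" and PN: "\<And>x. x \<in> N \<Longrightarrow> P x = 0"
  shows "is_direct_sum S M N"
  unfolding is_direct_sum_def
proof
  show "S = {s + t |s t. s \<in> M \<and> t \<in> N}"
  proof
    show "S \<subseteq> {s + t |s t. s \<in> M \<and> t \<in> N}"
    proof
      fix x
      assume "x \<in> S"
      moreover have "x = P x + (x - P x)"
        by simp
      ultimately show "x \<in> {s + t |s t. s \<in> M \<and> t \<in> N}"
        using decomp by blast
    qed
    show "{s + t |s t. s \<in> M \<and> t \<in> N} \<subseteq> S"
      using assms(4,5) scaleC.subspace_add[OF S] by auto
  qed
  have "x = 0" if "x \<in> M" "x \<in> N" for x
    using PM[OF that(1)] PN[OF that(2)] by simp
  then show "M \<inter> N = {0}"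
    using scaleC.subspace_0[OF M] scaleC.subspace_0[OF N] by auto
qed

lemma bounded_linear_maps_closure:
  assumes "bounded_linear f" and "\<And>x. x \<in> S \<Longrightarrow> f x \<in> T" and "x \<in> closure S"
  shows "f x \<in> closure T"
proof -
  have "f ` S \<subseteq> closure T"
    using assms(2) closure_subset by fastforce
  then have "f ` closure S \<subseteq> closure T"
    by (intro image_closure_subset linear_continuous_on assms(1) closed_closure)
  then show ?thesis
    using assms(3) by auto
qed

lemma bounded_linear_eq_on_closure:
  assumes "bounded_linear f" "bounded_linear g" and "\<And>x. x \<in> S \<Longrightarrow> f x = g x" and "x \<in> closure S"
  shows "f x = g x"
proof -
  have "closed {x. f x = g x}"
    by (intro closed_Collect_eq linear_continuous_on assms)
  moreover have "S \<subseteq> {x. f x = g x}"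
    using assms(3) by auto
  ultimately have "closure S \<subseteq> {x. f x = g x}"
    by (rule closure_minimal[rotated])
  then show ?thesis
    using assms(4) by auto
qed

text \<open>The single projection \<open>P\<close> splits both the range of \<open>B\<close> and its
  closure: its identities on the ranges extend by continuity. The factor \<open>E\<close> places the
  ranges of \<open>A\<close> and \<open>C\<close> inside that of \<open>B\<close>.\<close>

lemma direct_sums_of_factorizations:
  assumes A: "bounded_clinear A" and B: "bounded_clinear B"
    and P: "bounded_clinear P" "P \<circ> P = P"
    and AP: "A = P \<circ> B" and AE: "A = B \<circ> E"
  defines "C \<equiv> \<lambda>x. B x - A x"
  shows "is_direct_sum (range B) (range A) (range C)"
    and "is_direct_sum (closure (range B)) (closure (range A)) (closure (range C))"
proof -
  have P': "bounded_linear P"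
    using P(1) by (rule bounded_clinear_imp_bounded_linear)
  interpret P: bounded_linear P
    by (rule P')
  interpret B: bounded_linear B
    using B by (rule bounded_clinear_imp_bounded_linear)
  have C: "bounded_clinear C"
    unfolding C_def using B A by (rule bounded_clinear_diff)
  have PB: "P (B x) = A x" and BE: "B (E x) = A x" for x
    using AP AE by (metis comp_apply)+
  have PA: "P (A x) = A x" for x
    using P(2) AP by (metis comp_apply)
  have PC: "P (C x) = 0" for x
    by (simp add: C_def P.diff PB PA)
  \<comment> \<open>This exhibits \<open>x - E x\<close> as a preimage of \<open>C x\<close> under
    \<open>B\<close>.\<close>
  have CE: "B (x - E x) = C x" for x
    by (simp add: C_def B.diff BE)
  have sub: "range A \<subseteq> range B" "range C \<subseteq> range B"
    by (metis BE image_subsetI rangeI) (metis CE image_subsetI rangeI)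
  have decomp: "P y \<in> range A \<and> y - P y \<in> range C" if "y \<in> range B" for y
    using that by (auto simp: PB C_def)
  note subspaces = subspace_range[OF A] subspace_range[OF B] subspace_range[OF C]
  show "is_direct_sum (range B) (range A) (range C)"
    by (rule is_direct_sumI[where P = P]) (use subspaces sub decomp PA PC in auto)
  have id_P: "bounded_linear (\<lambda>y. y - P y)"
    by (intro bounded_linear_sub bounded_linear_ident P')
  show "is_direct_sum (closure (range B)) (closure (range A)) (closure (range C))"
  proof (rule is_direct_sumI[where P = P])
    fix y
    assume y: "y \<in> closure (range B)"
    have "P y \<in> closure (range A)"
      using P' _ y by (rule bounded_linear_maps_closure) (use decomp in blast)
    moreover have "y - P y \<in> closure (range C)"
      using id_P _ y by (rule bounded_linear_maps_closure) (use decomp in blast)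
    ultimately show "P y \<in> closure (range A) \<and> y - P y \<in> closure (range C)" ..
  next
    show "P x = x" if "x \<in> closure (range A)" for x
      using P' bounded_linear_ident _ that by (rule bounded_linear_eq_on_closure) (auto simp: PA)
    show "P x = 0" if "x \<in> closure (range C)" for x
      using P' bounded_linear_zero _ that by (rule bounded_linear_eq_on_closure) (auto simp: PC)
  qed (use subspaces sub in \<open>auto intro!: subspace_closure closure_mono del: subsetI\<close>)
qed

text \<open>The sum of closures provides the left projection \<open>P\<close>; the sum of ranges
  provides, through the Douglas factor \<open>D\<close> of \<open>A = B \<circ> D\<close>, the
  projection \<open>Q = cadjoint D\<close>.\<close>

lemma minus_le_if_direct_sums:
  assumes A: "bounded_clinear A" and B: "bounded_clinear B"
  defines "C \<equiv> \<lambda>x. B x - A x"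
  assumes range_sum: "is_direct_sum (range B) (range A) (range C)"
    and closure_sum: "is_direct_sum (closure (range B)) (closure (range A)) (closure (range C))"
  shows "minus_le A B"
proof -
  have C: "bounded_clinear C"
    unfolding C_def using B A by (rule bounded_clinear_diff)
  interpret B: bounded_linear B
    using B by (rule bounded_clinear_imp_bounded_linear)
  obtain P where P: "bounded_clinear P" and PM: "\<And>x. P x \<in> closure (range A)"
    and P_id: "\<And>x. x \<in> closure (range A) \<Longrightarrow> P x = x"
    and P_0: "\<And>x. x \<in> closure (range C) \<Longrightarrow> P x = 0"
    using oblique_projection_exists[OF subspace_closure[OF subspace_range[OF A]] closed_closure
        subspace_closure[OF subspace_range[OF C]] closed_closure closure_sum closed_closure]
    by blast
  interpret P: bounded_linear P
    using P by (rule bounded_clinear_imp_bounded_linear)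
  have PA: "P (A x) = A x" for x
    by (rule P_id) (rule subsetD[OF closure_subset rangeI])
  have PB: "P (B x) = A x" for x
  proof -
    have "P (C x) = 0"
      by (rule P_0) (rule subsetD[OF closure_subset rangeI])
    then show ?thesis
      by (simp add: C_def P.diff PA)
  qed
  \<comment> \<open>The zero vector of the range of \<open>C\<close> shows that the first summand
    lies in the sum.\<close>
  have "A x + 0 \<in> range B" for x
    using range_sum scaleC.subspace_0[OF subspace_range[OF C]] unfolding is_direct_sum_def by blast
  then have "range A \<subseteq> range B"
    by auto
  then obtain D where D: "bounded_clinear D" and BD: "\<And>x. B (D x) = A x"
    and orth: "\<And>x k. B k = 0 \<Longrightarrow> cinner (D x) k = 0"
    using douglas_factorization[OF A B] by blast
  have DD: "D (D x) = D x" for x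
  proof -
    \<comment> \<open>Both sides equal \<open>A (D x)\<close>. Since \<open>B (D x) = A x\<close> is
      fixed by \<open>P\<close>, the right side is also \<open>B (D x)\<close>.\<close>
    have "B (D (D x)) = P (B (D x))"
      by (simp only: PB BD[of "D x"])
    then have "B (D (D x) - D x) = 0"
      by (simp add: BD PA B.diff)
    \<comment> \<open>The difference lies in the kernel of \<open>B\<close>, while all values of
      \<open>D\<close> are orthogonal to that kernel; so it is orthogonal to itself.\<close>
    then have "cinner (D (D x) - D x) (D (D x) - D x) = 0"
      by (subst cinner_diff_left) (simp add: orth)
    then show ?thesis
      by (simp add: cinner_self)
  qed
  have "cadjoint D (cadjoint D y) = cadjoint D y" for y
    by (rule cinner_ext) (simp add: DD flip: cinner_cadjoint[OF D])
  then have "cadjoint D \<circ> cadjoint D = cadjoint D"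
    by auto
  moreover have "cadjoint A = cadjoint D \<circ> cadjoint B"
    by (rule cadjoint_eqI) (simp add: BD flip: cinner_cadjoint[OF D] cinner_cadjoint[OF B])
  \<comment> \<open>Idempotence holds because \<open>P\<close> maps into the closure of the range of
    \<open>A\<close>, where it is the identity.\<close>
  moreover have "P \<circ> P = P" "A = P \<circ> B"
    using P_id[OF PM] PB by auto
  ultimately show ?thesis
    unfolding minus_le_def using P bounded_clinear_cadjoint[OF D] by blast
qed

theorem corollary3p4:
  fixes A B :: "'a \<Rightarrow> 'a::complex_hilbert_space"
  assumes "bounded_clinear A" and "bounded_clinear B"
  shows "minus_le A B \<longleftrightarrow>
    is_direct_sum (range B) (range A) (range (\<lambda>x. B x - A x)) \<and>
    is_direct_sum (closure (range B)) (closure (range A)) (closure (range (\<lambda>x. B x - A x)))"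
proof
  assume "minus_le A B"
  then obtain P E where "bounded_clinear P" "P \<circ> P = P" "A = P \<circ> B" "A = B \<circ> E"
    using minus_le_imp_factor[OF assms] by blast
  then show "is_direct_sum (range B) (range A) (range (\<lambda>x. B x - A x)) \<and>
      is_direct_sum (closure (range B)) (closure (range A)) (closure (range (\<lambda>x. B x - A x)))"
    using direct_sums_of_factorizations[OF assms] by blast
qed (use minus_le_if_direct_sums[OF assms] in blast)

end
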